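(* For all $x\in\mathbb{B}^2\setminus\{0\}$ and $l>0$, $$B_h(x,l)=\left\{\,y=x+k\left(x-\frac{x}{|x|}e^{\psi i}\right)\;\middle|\;\psi\in[0,2\pi),\ 0\le k<k_1(\psi)\right\},$$ where $$k_1(\psi)=\frac{(1-|x|^2)(e^l-1)}{1-|x|^2+e^l\left(1+|x|^2-2|x|\cos(\psi)\right)}.$$
   Context: $\mathbb{B}^2$ is the open unit disk, with $\mathbb{R}^2$ identified with the complex plane, and $S^1$ is the unit circle. For distinct $x,y\in\mathbb{R}^2$, $L(x,y)$ denotes the Euclidean line through $x$ and $y$. Hilbert metric: for distinct $x,y\in\mathbb{B}^2$, $$h_{\mathbb{B}^2}(x,y)=\log\frac{|u-y|\,|x-v|}{|u-x|\,|y-v|},$$ where $u,v$ are the two points of $L(x,y)\cap S^{1}$, ordered so that $|u-x|<|u-y|$; and $h_{\mathbb{B}^2}(x,x)=0$. The logarithm is natural. $B_h(x,l)=\{y\in\mathbb{B}^2: h_{\mathbb{B}^2}(x,y)<l\}$ is the open ball in the Hilbert metric. *)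

theory Defs
  imports "HOL-Analysis.Analysis"
begin

definition line_through :: "complex \<Rightarrow> complex \<Rightarrow> complex set" where
  "line_through x y = affine hull {x, y}"

(* For distinct x, y in the open unit disk the line meets the unit circle in exactly
   two points, and exactly one of their two orderings satisfies the inequality, so the
   description is proper there. Values for points outside the disk carry no meaning. *)
definition hilbert_endpoints :: "complex \<Rightarrow> complex \<Rightarrow> complex \<times> complex" where
  "hilbert_endpoints x y =
     (THE (u, v). line_through x y \<inter> sphere 0 1 = {u, v} \<and> u \<noteq> v \<and> cmod (u - x) < cmod (u - y))"

definition hilbert_dist :: "complex \<Rightarrow> complex \<Rightarrow> real" where
  "hilbert_dist x y =
     (if x = y then 0
      else let (u, v) = hilbert_endpoints x y
           in ln ((cmod (u - y) * cmod (x - v)) / (cmod (u - x) * cmod (y - v))))"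

definition hilbert_ball :: "complex \<Rightarrow> real \<Rightarrow> complex set" where
  "hilbert_ball x l = {y \<in> ball 0 1. hilbert_dist x y < l}"

definition k1 :: "complex \<Rightarrow> real \<Rightarrow> real \<Rightarrow> real" where
  "k1 x l \<psi> = ((1 - (cmod x)\<^sup>2) * (exp l - 1))
              / (1 - (cmod x)\<^sup>2 + exp l * (1 + (cmod x)\<^sup>2 - 2 * cmod x * cos \<psi>))"

end

theory Submission
  imports Defs
begin

text \<open>
  Fix a point \<open>p\<close> of the unit circle and put \<open>w = x - p\<close>. Along the line through \<open>p\<close> and \<open>x\<close>,
  parametrised as \<open>x + t w\<close>, the polynomial \<open>|x + t w|\<^sup>2 - 1\<close> is quadratic in \<open>t\<close>, vanishes at
  \<open>t = -1\<close> (the point \<open>p\<close>), and has product of roots \<open>(|x|\<^sup>2 - 1) / |w|\<^sup>2\<close>. The second root is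
  therefore \<open>T = (1 - |x|\<^sup>2) / |w|\<^sup>2\<close> (lemma \<open>norm_point_on_chord\<close>), so the chord is given
  explicitly and no square root appears. This is why the ball is described by the rays that lead
  away from points of the circle, and not by an angle at \<open>x\<close>.

  For a point \<open>y = x + k w\<close> with \<open>0 < k < T\<close>, the ends of the chord in the order required by the
  Hilbert metric are \<open>p\<close> and \<open>x + T w\<close>. The cross ratio becomes \<open>(1 + k) T / (T - k)\<close>
  (lemma \<open>hilbert_dist_on_chord\<close>), and its logarithm is below \<open>l\<close> exactly if
  \<open>k < T (e\<^sup>l - 1) / (T + e\<^sup>l)\<close>. Substituting \<open>T\<close>, and \<open>|w|\<^sup>2\<close> by the law of cosines, turns this
  bound into \<open>k1\<close>. Finally, every point of the disk lies on such a ray, because the ray from \<open>y\<close>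
  through \<open>x\<close> leaves the disk at some point \<open>p\<close> (lemma \<open>disk_point_on_ray\<close>).
\<close>

lemma norm_mult_nonneg_real: "0 \<le> c \<Longrightarrow> cmod (of_real c * z) = c * cmod z"
  by (simp add: norm_mult)

text \<open>The ratio of the distances from \<open>x\<close> to the far end of the chord through \<open>p\<close> and \<open>x\<close>, and
  to \<open>p\<close>: the far end is \<open>x + T (x - p)\<close>.\<close>

definition chord_param :: "complex \<Rightarrow> complex \<Rightarrow> real" where
  "chord_param x p = (1 - (cmod x)\<^sup>2) / (cmod (x - p))\<^sup>2"

lemma chord_param_pos:
  assumes "cmod x < 1" "cmod p = 1"
  shows "chord_param x p > 0"
proof -
  have "x \<noteq> p" using assms by auto
  moreover have "(cmod x)\<^sup>2 < 1"
    using assms(1) by (simp add: abs_square_less_1)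
  ultimately show ?thesis by (simp add: chord_param_def)
qed

text \<open>Both sides are quadratic in \<open>t\<close>; the roots on the right come from \<open>p\<close> and from the product
  of the roots.\<close>

lemma norm_point_on_chord:
  assumes "cmod x < 1" "cmod p = 1"
  shows "(cmod (x + of_real t * (x - p)))\<^sup>2
           = 1 + (cmod (x - p))\<^sup>2 * ((t + 1) * (t - chord_param x p))"
proof -
  let ?W = "(cmod (x - p))\<^sup>2" and ?T = "chord_param x p"
  have "x \<noteq> p" using assms by auto
  then have T: "?W * ?T = 1 - (cmod x)\<^sup>2"
    by (simp add: chord_param_def)
  have p: "(Re p)\<^sup>2 + (Im p)\<^sup>2 = 1"
    using assms(2) by (metis cmod_power2 power_one)
  have "(cmod (x + of_real t * (x - p)))\<^sup>2
      = (1 + t) * (cmod x)\<^sup>2 + t * (1 + t) * ?W - t * ((Re p)\<^sup>2 + (Im p)\<^sup>2)"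
    unfolding cmod_power2 by (simp add: power2_eq_square algebra_simps)
  also have "\<dots> = 1 + t * (1 + t) * ?W - (1 + t) * (?W * ?T)"
    unfolding p T by (simp add: algebra_simps)
  also have "\<dots> = 1 + ?W * ((t + 1) * (t - ?T))"
    by (simp add: algebra_simps)
  finally show ?thesis .
qed

lemma on_circle_iff_chord_end:
  assumes "cmod x < 1" "cmod p = 1"
  shows "cmod (x + of_real t * (x - p)) = 1 \<longleftrightarrow> t = - 1 \<or> t = chord_param x p"
proof -
  have "x \<noteq> p" using assms by auto
  have "cmod (x + of_real t * (x - p)) = 1 \<longleftrightarrow> (cmod (x + of_real t * (x - p)))\<^sup>2 = 1"
    by (simp add: power2_eq_1_iff) (use norm_ge_zero[of "x + of_real t * (x - p)"] in linarith)
  also have "\<dots> \<longleftrightarrow> t = - 1 \<or> t = chord_param x p"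
    unfolding norm_point_on_chord[OF assms] using \<open>x \<noteq> p\<close> by (auto simp: add_eq_0_iff)
  finally show ?thesis .
qed

lemma in_disk_iff_below_chord_end:
  assumes "cmod x < 1" "cmod p = 1" "0 \<le> t"
  shows "cmod (x + of_real t * (x - p)) < 1 \<longleftrightarrow> t < chord_param x p"
proof -
  have "x \<noteq> p" using assms by auto
  have "cmod (x + of_real t * (x - p)) < 1 \<longleftrightarrow> (cmod (x + of_real t * (x - p)))\<^sup>2 < 1"
    by (simp add: abs_square_less_1)
  also have "\<dots> \<longleftrightarrow> t < chord_param x p"
    unfolding norm_point_on_chord[OF assms(1,2)] using \<open>x \<noteq> p\<close> assms(3)
    by (simp add: mult_less_0_iff)
  finally show ?thesis .
qed

lemma line_through_ray_point:
  assumes "k \<noteq> 0"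
  shows "line_through x (x + of_real k * w) = range (\<lambda>t. x + of_real t * w)"
proof -
  have "line_through x (x + of_real k * w) = range (\<lambda>s. x + of_real (s * k) * w)"
    unfolding line_through_def affine_hull_2_alt by (simp add: scaleR_conv_of_real mult.assoc)
  also have "\<dots> = (\<lambda>t. x + of_real t * w) ` range (\<lambda>s. s * k)"
    by (simp add: image_image)
  also have "range (\<lambda>s. s * k) = UNIV"
    using assms by (intro surjI[of _ "\<lambda>t. t / k"]) simp
  finally show ?thesis .
qed

lemma hilbert_endpoints_on_chord:
  assumes x: "cmod x < 1" and p: "cmod p = 1" and k: "0 < k" "k < chord_param x p"
  defines "y \<equiv> x + of_real k * (x - p)"
  shows "hilbert_endpoints x y = (p, x + of_real (chord_param x p) * (x - p))"
proof -
  let ?T = "chord_param x p"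
  define w where "w = x - p"
  define q where "q = x + of_real ?T * w"
  have T: "?T > 0" using chord_param_pos[OF x p] .
  have w: "cmod w > 0" unfolding w_def using x p by auto
  have pw: "p = x + of_real (- 1) * w" by (simp add: w_def)
  have "line_through x y \<inter> sphere 0 1 = (\<lambda>t. x + of_real t * w) ` {t. cmod (x + of_real t * w) = 1}"
    using line_through_ray_point[of k x w] k by (auto simp: y_def w_def)
  also have "{t. cmod (x + of_real t * w) = 1} = {- 1, ?T}"
    unfolding w_def on_circle_iff_chord_end[OF x p] by blast
  also have "(\<lambda>t. x + of_real t * w) ` {- 1, ?T} = {p, q}"
    unfolding image_insert image_empty pw[symmetric] q_def ..
  finally have ends: "line_through x y \<inter> sphere 0 1 = {p, q}" .
  have "p - q = - (of_real (1 + ?T) * w)"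
    by (simp add: pw q_def algebra_simps)
  then have "cmod (p - q) = (1 + ?T) * cmod w"
    using T by (simp add: norm_mult_nonneg_real del: of_real_add of_real_diff)
  then have pq: "p \<noteq> q" using T w by auto
  have near: "cmod (p - x) < cmod (p - y)"
  proof -
    have "p - x = - w" by (simp add: w_def)
    then have "cmod (p - x) = cmod w" by simp
    moreover have "p - y = - (of_real (1 + k) * w)"
      by (simp add: y_def w_def algebra_simps)
    then have "cmod (p - y) = (1 + k) * cmod w"
      using k by (simp add: norm_mult_nonneg_real del: of_real_add of_real_diff)
    ultimately show ?thesis using k w by (simp add: algebra_simps)
  qed
  have far: "\<not> cmod (q - x) < cmod (q - y)"
  proof -
    have "q - x = of_real ?T * w" by (simp add: q_def)
    then have "cmod (q - x) = ?T * cmod w" using T by (simp add: norm_mult)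
    moreover have "q - y = of_real (?T - k) * w"
      by (simp add: q_def y_def w_def algebra_simps)
    then have "cmod (q - y) = (?T - k) * cmod w"
      using k by (simp add: norm_mult_nonneg_real del: of_real_diff)
    ultimately show ?thesis using k w by simp
  qed
  have "hilbert_endpoints x y = (p, q)"
    unfolding hilbert_endpoints_def ends
    by (rule the_equality) (use pq near far in \<open>auto simp: doubleton_eq_iff\<close>)
  then show ?thesis by (simp add: q_def w_def)
qed

text \<open>Every distance in the cross ratio is a multiple of \<open>|x - p|\<close>, which cancels.\<close>

lemma hilbert_dist_on_chord:
  assumes x: "cmod x < 1" and p: "cmod p = 1" and k: "0 \<le> k" "k < chord_param x p"
  shows "hilbert_dist x (x + of_real k * (x - p))
           = ln ((1 + k) * chord_param x p / (chord_param x p - k))"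
proof (cases "k = 0")
  case True
  then show ?thesis using k by (simp add: hilbert_dist_def)
next
  case False
  let ?T = "chord_param x p"
  define w where "w = x - p"
  define y where "y = x + of_real k * w"
  define q where "q = x + of_real ?T * w"
  have T: "?T > 0" using chord_param_pos[OF x p] .
  have w: "cmod w > 0" unfolding w_def using x p by auto
  have "p - x = - w" by (simp add: w_def)
  then have px: "cmod (p - x) = cmod w" by simp
  have "p - y = - (of_real (1 + k) * w)"
    by (simp add: y_def w_def algebra_simps)
  then have py: "cmod (p - y) = (1 + k) * cmod w"
    using k by (simp add: norm_mult_nonneg_real del: of_real_add of_real_diff)
  have "x - q = - (of_real ?T * w)" by (simp add: q_def)
  then have xq: "cmod (x - q) = ?T * cmod w"
    using T by (simp add: norm_mult_nonneg_real del: of_real_add of_real_diff)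
  have "y - q = - (of_real (?T - k) * w)"
    by (simp add: q_def y_def algebra_simps)
  then have yq: "cmod (y - q) = (?T - k) * cmod w"
    using k by (simp add: norm_mult_nonneg_real del: of_real_add of_real_diff)
  have "x \<noteq> y" using False w by (auto simp: y_def)
  moreover have "hilbert_endpoints x y = (p, q)"
    using hilbert_endpoints_on_chord[OF x p _ k(2)] False k by (simp add: y_def q_def w_def)
  ultimately have "hilbert_dist x y
      = ln (((1 + k) * cmod w * (?T * cmod w)) / (cmod w * ((?T - k) * cmod w)))"
    by (simp add: hilbert_dist_def px py xq yq)
  also have "\<dots> = ln ((1 + k) * ?T / (?T - k))"
    using w by simp
  finally show ?thesis by (simp add: y_def w_def)
qed

text \<open>The distance tends to infinity as \<open>k\<close> approaches the chord parameter, so the bound on \<open>k\<close> that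
  expresses \<open>hilbert_dist < l\<close> lies below that parameter and by itself keeps the point inside the
  disk.\<close>

lemma in_hilbert_ball_on_chord:
  assumes x: "cmod x < 1" and p: "cmod p = 1" and k: "0 \<le> k"
  shows "x + of_real k * (x - p) \<in> hilbert_ball x l \<longleftrightarrow>
    k < ((1 - (cmod x)\<^sup>2) * (exp l - 1)) / (1 - (cmod x)\<^sup>2 + exp l * (cmod (x - p))\<^sup>2)"
proof -
  let ?T = "chord_param x p" and ?W = "(cmod (x - p))\<^sup>2"
  have T: "?T > 0" using chord_param_pos[OF x p] .
  have W: "?W > 0" using x p by auto
  have WT: "1 - (cmod x)\<^sup>2 = ?W * ?T" using W by (simp add: chord_param_def)
  have "?T * (exp l - 1) < ?T * (?T + exp l)"
    using T by (intro mult_strict_left_mono) auto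
  then have less: "?T * (exp l - 1) / (?T + exp l) < ?T"
    using T by (simp add: pos_divide_less_eq add_pos_pos)
  have "x + of_real k * (x - p) \<in> hilbert_ball x l \<longleftrightarrow>
      k < ?T \<and> ln ((1 + k) * ?T / (?T - k)) < l"
    using in_disk_iff_below_chord_end[OF x p k] hilbert_dist_on_chord[OF x p k]
    by (auto simp: hilbert_ball_def)
  also have "\<dots> \<longleftrightarrow> k < ?T \<and> (1 + k) * ?T < exp l * (?T - k)"
  proof (rule conj_cong[OF refl])
    assume kT: "k < ?T"
    then have "0 < (1 + k) * ?T / (?T - k)" using k T by simp
    then have "ln ((1 + k) * ?T / (?T - k)) < l \<longleftrightarrow> (1 + k) * ?T / (?T - k) < exp l"
      by (metis exp_less_cancel_iff exp_ln)
    also have "\<dots> \<longleftrightarrow> (1 + k) * ?T < exp l * (?T - k)"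
      using kT by (simp add: pos_divide_less_eq)
    finally show "ln ((1 + k) * ?T / (?T - k)) < l \<longleftrightarrow> (1 + k) * ?T < exp l * (?T - k)" .
  qed
  also have "\<dots> \<longleftrightarrow> k < ?T \<and> k * (?T + exp l) < ?T * (exp l - 1)"
    by (simp add: algebra_simps)
  also have "\<dots> \<longleftrightarrow> k < ?T \<and> k < ?T * (exp l - 1) / (?T + exp l)"
    using T by (simp add: pos_less_divide_eq add_pos_pos)
  also have "\<dots> \<longleftrightarrow> k < ?T * (exp l - 1) / (?T + exp l)"
    using less by linarith
  also have "?T * (exp l - 1) / (?T + exp l)
      = (?W * (?T * (exp l - 1))) / (?W * (?T + exp l))"
    using W by simp
  also have "\<dots> = ((1 - (cmod x)\<^sup>2) * (exp l - 1)) / (1 - (cmod x)\<^sup>2 + exp l * ?W)"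
    unfolding WT by (simp add: algebra_simps)
  finally show ?thesis .
qed

text \<open>The point \<open>p\<close> is where the ray from \<open>y\<close> through \<open>x\<close> leaves the disk.\<close>

lemma disk_point_on_ray:
  assumes x: "cmod x < 1"
  obtains p k where "cmod p = 1" "0 \<le> k" "y = x + of_real k * (x - p)"
proof (cases "y = x")
  case True
  with that[of 1 0] show ?thesis by simp
next
  case False
  then have "x - y \<noteq> 0" by simp
  moreover have "x \<in> interior (ball 0 1)" using x by simp
  ultimately obtain d where d: "0 < d" "x + d *\<^sub>R (x - y) \<in> frontier (ball 0 1)"
    using ray_to_frontier[OF bounded_ball] by blast
  define p where "p = x + of_real d * (x - y)"
  have "cmod p = 1"
    using d(2) by (simp add: p_def scaleR_conv_of_real)
  moreover have "y = x + of_real (1 / d) * (x - p)"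
    using d(1) by (simp add: p_def field_simps)
  ultimately show ?thesis using that[of p "1 / d"] d(1) by simp
qed

lemma circle_point_polar:
  assumes "x \<noteq> 0" "cmod p = 1"
  obtains \<psi> where "\<psi> \<in> {0..<2 * pi}" "p = x / of_real (cmod x) * exp (\<i> * of_real \<psi>)"
proof -
  let ?e = "x / of_real (cmod x)"
  have "?e \<noteq> 0" using assms by simp
  have "cmod (p / ?e) = 1" using assms by (simp add: norm_divide norm_mult)
  then have "p / ?e = exp (\<i> * of_real (Arg2pi (p / ?e)))"
    using Arg2pi_eq[of "p / ?e"] by simp
  then have "p = ?e * exp (\<i> * of_real (Arg2pi (p / ?e)))"
    using \<open>?e \<noteq> 0\<close> by (metis nonzero_mult_div_cancel_left times_divide_eq_right)
  then show ?thesis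
    using that[of "Arg2pi (p / ?e)"] Arg2pi_ge_0[of "p / ?e"] Arg2pi_lt_2pi[of "p / ?e"] by simp
qed

lemma law_of_cosines_circle:
  assumes "x \<noteq> 0"
  shows "(cmod (x - x / of_real (cmod x) * exp (\<i> * of_real \<psi>)))\<^sup>2
           = 1 + (cmod x)\<^sup>2 - 2 * cmod x * cos \<psi>"
proof -
  have "x - x / of_real (cmod x) * exp (\<i> * of_real \<psi>)
      = x / of_real (cmod x) * (of_real (cmod x) - cis \<psi>)"
    using assms by (simp add: cis_conv_exp field_simps)
  then have "cmod (x - x / of_real (cmod x) * exp (\<i> * of_real \<psi>)) = cmod (of_real (cmod x) - cis \<psi>)"
    using assms by (simp add: norm_mult norm_divide)
  also have "(cmod (of_real (cmod x) - cis \<psi>))\<^sup>2 = (cmod x - cos \<psi>)\<^sup>2 + (sin \<psi>)\<^sup>2"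
    by (simp add: cmod_power2)
  also have "\<dots> = 1 + (cmod x)\<^sup>2 - 2 * cmod x * cos \<psi>"
    by (simp add: sin_squared_eq power2_diff)
  finally show ?thesis .
qed

theorem lemma5p3:
  fixes x :: complex and l :: real
  assumes "x \<in> ball 0 1 - {0}" and "l > 0"
  shows "hilbert_ball x l =
    {x + of_real k * (x - x / of_real (cmod x) * exp (\<i> * of_real \<psi>)) | \<psi> k.
       \<psi> \<in> {0..<2 * pi} \<and> 0 \<le> k \<and> k < k1 x l \<psi>}"
proof -
  have x: "cmod x < 1" "x \<noteq> 0" using assms by auto
  define P where "P \<psi> = x / of_real (cmod x) * exp (\<i> * of_real \<psi>)" for \<psi> :: real
  have "cmod (P \<psi>) = 1" for \<psi>
    using x by (simp add: P_def norm_mult norm_divide)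
  from in_hilbert_ball_on_chord[OF x(1) this]
  have mem: "x + of_real k * (x - P \<psi>) \<in> hilbert_ball x l \<longleftrightarrow> k < k1 x l \<psi>"
    if "0 \<le> k" for k \<psi>
    using that law_of_cosines_circle[OF x(2), of \<psi>] by (simp add: k1_def P_def)
  have "hilbert_ball x l = {x + of_real k * (x - P \<psi>) | \<psi> k.
      \<psi> \<in> {0..<2 * pi} \<and> 0 \<le> k \<and> k < k1 x l \<psi>}" (is "_ = ?R")
  proof
    show "hilbert_ball x l \<subseteq> ?R"
    proof
      fix y assume y: "y \<in> hilbert_ball x l"
      obtain p k where p: "cmod p = 1" and k: "0 \<le> k" and eq: "y = x + of_real k * (x - p)"
        by (rule disk_point_on_ray[OF x(1)])
      obtain \<psi> where \<psi>: "\<psi> \<in> {0..<2 * pi}" "p = P \<psi>"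
        unfolding P_def by (rule circle_point_polar[OF x(2) p])
      then have "k < k1 x l \<psi>" using y k mem eq by blast
      then show "y \<in> ?R" using \<psi> k eq by blast
    qed
    show "?R \<subseteq> hilbert_ball x l" using mem by blast
  qed
  then show ?thesis by (simp add: P_def)
qed

end
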